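(* Let $A\in\mathbb{R}^{k\times n}$, let $\Gamma_{\mathrm{prior}}\in\mathbb{R}^{n\times n}$ and $\Gamma_{\mathrm{noise}}\in\mathbb{R}^{k\times k}$ be symmetric positive definite matrices, let $\Gamma_{\mathrm{post}}:=(\Gamma_{\mathrm{prior}}^{-1}+A^\top\Gamma_{\mathrm{noise}}^{-1}A)^{-1}$, and let $\delta_{\mathrm{noise}}:=\operatorname{tr}\left[A^+\Gamma_{\mathrm{noise}}(A^+)^\top-A^+A\,\Gamma_{\mathrm{post}}\right]$. Then $$\delta_{\mathrm{noise}}\le\operatorname{tr}\left[A^+\Gamma_{\mathrm{noise}}(A^+)^\top\right].$$
   Context: $A^+$ denotes the Moore–Penrose pseudoinverse of $A$. *)

theory Defs
  imports "HOL-Analysis.Analysis"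
begin

definition symmetric_pos_def :: "real^'n^'n \<Rightarrow> bool" where
  "symmetric_pos_def M \<longleftrightarrow>
     transpose M = M \<and> (\<forall>x. x \<noteq> 0 \<longrightarrow> 0 < x \<bullet> (M *v x))"

text \<open>The four Penrose conditions for a real matrix.\<close>

definition is_pseudoinverse :: "real^'n^'k \<Rightarrow> real^'k^'n \<Rightarrow> bool" where
  "is_pseudoinverse A X \<longleftrightarrow>
     A ** X ** A = A \<and> X ** A ** X = X \<and>
     transpose (A ** X) = A ** X \<and> transpose (X ** A) = X ** A"

definition pseudoinverse :: "real^'n^'k \<Rightarrow> real^'k^'n" where
  "pseudoinverse A = (THE X. is_pseudoinverse A X)"

lemma is_pseudoinverse_unique:
  assumes "is_pseudoinverse A X" "is_pseudoinverse A Y"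
  shows "X = Y"
proof -
  note X = assms(1)[unfolded is_pseudoinverse_def]
  note Y = assms(2)[unfolded is_pseudoinverse_def]
  have "A ** X = transpose (A ** X)" using X by simp
  also have "\<dots> = transpose ((A ** Y) ** (A ** X))"
    using Y by (simp add: matrix_mul_assoc)
  also have "\<dots> = (A ** X) ** (A ** Y)"
    using X Y by (simp add: matrix_transpose_mul[of "A ** Y" "A ** X"])
  also have "\<dots> = A ** Y" using X by (simp add: matrix_mul_assoc)
  finally have AX: "A ** X = A ** Y" .
  have "X ** A = transpose (X ** A)" using X by simp
  also have "\<dots> = transpose ((X ** A) ** (Y ** A))"
    using Y by (simp flip: matrix_mul_assoc)
  also have "\<dots> = (Y ** A) ** (X ** A)"
    using X Y by (simp add: matrix_transpose_mul[of "X ** A" "Y ** A"])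
  also have "\<dots> = Y ** A" using X by (simp flip: matrix_mul_assoc)
  finally have XA: "X ** A = Y ** A" .
  have "X = X ** A ** X" using X by simp
  also have "\<dots> = Y ** (A ** X)" using XA by (simp add: matrix_mul_assoc)
  also have "\<dots> = Y" using AX Y by (simp add: matrix_mul_assoc)
  finally show ?thesis .
qed

lemma ex_inner_inverse:
  fixes A :: "real^'n^'k"
  shows "\<exists>G. A ** G ** A = A"
proof -
  have "linear ((*v) A)" by (rule matrix_vector_mul_linear)
  from linear_exists_right_inverse_on[OF this subspace_UNIV]
  obtain g where g: "linear g" and Ag: "\<And>x. A *v g (A *v x) = A *v x"
    by auto
  have "A ** matrix g ** A = A"
    unfolding matrix_eq using Ag
    by (simp add: matrix_works g
        flip: matrix_vector_mul_assoc)
  then show ?thesis by blast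
qed

lemma ex_least_squares_inverse:
  fixes A :: "real^'n^'k"
  shows "\<exists>G. A ** G ** transpose A ** A = A"
proof -
  define B where "B = transpose A ** A"
  obtain G where G: "B ** G ** B = B"
    using ex_inner_inverse by blast
  define C where "C = G ** B"
  have "A *v (C *v x) = A *v x" for x
  proof -
    define z where "z = C *v x - x"
    have "B *v z = 0"
      using G by (simp add: z_def C_def matrix_vector_mult_diff_distrib
          matrix_vector_mul_assoc matrix_mul_assoc)
    then have "z \<bullet> (transpose A *v (A *v z)) = 0"
      by (simp add: B_def matrix_vector_mul_assoc)
    then have "(A *v z) \<bullet> (A *v z) = 0"
      by (simp add: dot_lmul_matrix flip: vector_transpose_matrix)
    then show ?thesis
      by (simp add: z_def matrix_vector_mult_diff_distrib)
  qed
  then have "A ** C = A"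
    by (simp add: matrix_eq flip: matrix_vector_mul_assoc)
  then show ?thesis
    unfolding C_def B_def by (metis matrix_mul_assoc)
qed

lemma ex_pseudoinverse:
  fixes A :: "real^'n^'k"
  shows "\<exists>X. is_pseudoinverse A X"
proof -
  let ?T = "transpose A"
  obtain G where G: "A ** G ** ?T ** A = A"
    using ex_least_squares_inverse by blast
  obtain H where H: "?T ** H ** A ** ?T = ?T"
    using ex_least_squares_inverse[of ?T] by (auto simp: transpose_transpose)
  have H': "A ** ?T ** transpose H ** A = A"
    using arg_cong[OF H, of transpose] by (simp add: matrix_transpose_mul matrix_mul_assoc)
  have G': "?T ** A ** transpose G ** ?T = ?T"
    using arg_cong[OF G, of transpose] by (simp add: matrix_transpose_mul matrix_mul_assoc)
  define K where "K = transpose H"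
  define X where "X = ?T ** K ** A ** G ** ?T"
  have AX: "A ** X = A ** G ** ?T"
    using H' by (simp add: X_def K_def matrix_mul_assoc)
  have XA: "X ** A = ?T ** K ** A"
    unfolding X_def using G by (metis matrix_mul_assoc)
  have sG: "transpose (A ** G ** ?T) = A ** G ** ?T"
  proof -
    have "A ** G ** ?T = A ** G ** (?T ** A ** transpose G ** ?T)" by (simp add: G')
    also have "\<dots> = A ** transpose G ** ?T" using G by (simp add: matrix_mul_assoc)
    finally show ?thesis by (simp add: matrix_transpose_mul matrix_mul_assoc)
  qed
  have sH: "transpose (?T ** K ** A) = ?T ** K ** A"
  proof -
    have "?T ** K ** A = (?T ** H ** A ** ?T) ** K ** A" by (simp add: H)
    also have "\<dots> = ?T ** H ** (A ** ?T ** K ** A)" by (simp add: matrix_mul_assoc)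
    also have "\<dots> = ?T ** H ** A" using H' by (simp add: K_def)
    finally show ?thesis by (simp add: K_def matrix_transpose_mul matrix_mul_assoc)
  qed
  have "X ** A ** X = ?T ** K ** (A ** ?T ** K ** A) ** G ** ?T"
    unfolding XA by (simp add: X_def matrix_mul_assoc)
  also have "\<dots> = X" using H' by (simp add: K_def X_def)
  finally have "is_pseudoinverse A X"
    using AX XA sG sH G by (simp add: is_pseudoinverse_def)
  then show ?thesis by blast
qed

lemma is_pseudoinverse_pseudoinverse: "is_pseudoinverse A (pseudoinverse A)"
  unfolding pseudoinverse_def
  by (rule theI') (use ex_pseudoinverse is_pseudoinverse_unique in blast)

end

theory Submission
  imports Defs
begin

text \<open>
  By linearity of the trace the claim amounts to
  \<open>tr (A\<^sup>+ A \<Gamma>_post) \<ge> 0\<close>. The matrix \<open>P = A\<^sup>+ A\<close> is an orthogonal projection,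
  so cyclicity of the trace gives \<open>tr (P \<Gamma>_post) = tr (P \<Gamma>_post P\<^sup>T)\<close>. Each diagonal entry of
  \<open>P \<Gamma>_post P\<^sup>T\<close> is the value of the quadratic form of \<open>\<Gamma>_post\<close> at \<open>P\<^sup>T e\<^sub>i\<close>. This is
  nonnegative because positive definiteness survives inversion, and survives adding a congruence
  transform \<open>B\<^sup>T N B\<close> of a positive definite \<open>N\<close>.
\<close>

lemma inner_congruence:
  fixes B :: "real^'n^'k" and N :: "real^'k^'k"
  shows "x \<bullet> ((transpose B ** N ** B) *v x) = (B *v x) \<bullet> (N *v (B *v x))"
proof -
  have "x \<bullet> ((transpose B ** N ** B) *v x) = x \<bullet> (transpose B *v (N *v (B *v x)))"
    by (simp add: matrix_vector_mul_assoc matrix_mul_assoc)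
  also have "\<dots> = (B *v x) \<bullet> (N *v (B *v x))"
    by (metis dot_lmul_matrix inner_commute transpose_matrix_vector)
  finally show ?thesis .
qed

lemma invertible_pos_def:
  fixes M :: "real^'n^'n"
  assumes "\<And>x. x \<noteq> 0 \<Longrightarrow> 0 < x \<bullet> (M *v x)"
  shows "invertible M"
proof -
  have "x = 0" if "M *v x = 0" for x
    using assms[of x] that by auto
  then show ?thesis
    by (simp add: invertible_left_inverse matrix_left_invertible_ker)
qed

text \<open>With \<open>y = M\<^sup>-\<^sup>1 x\<close> the form of the inverse at \<open>x\<close> is \<open>M y \<bullet> y\<close>, the form of \<open>M\<close> at \<open>y\<close>.\<close>

lemma pos_def_matrix_inv:
  fixes M :: "real^'n^'n"
  assumes pos: "\<And>x. x \<noteq> 0 \<Longrightarrow> 0 < x \<bullet> (M *v x)" and "x \<noteq> 0"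
  shows "0 < x \<bullet> (matrix_inv M *v x)"
proof -
  define y where "y = matrix_inv M *v x"
  have "M ** matrix_inv M = mat 1"
    using someI_ex[OF invertible_pos_def[OF pos, unfolded invertible_def]]
    by (simp add: matrix_inv_def)
  then have x: "x = M *v y"
    by (simp add: y_def matrix_vector_mul_assoc)
  with \<open>x \<noteq> 0\<close> have "y \<noteq> 0" by auto
  from pos[OF this] show ?thesis
    by (simp add: inner_commute flip: x y_def)
qed

lemma trace_congruence_nonneg:
  fixes P :: "real^'n^'k" and G :: "real^'n^'n"
  assumes "\<And>x. 0 \<le> x \<bullet> (G *v x)"
  shows "0 \<le> trace (P ** G ** transpose P)"
  unfolding trace_def
proof (rule sum_nonneg)
  fix i
  have "(P ** G ** transpose P) $ i $ i
      = axis i 1 \<bullet> ((transpose (transpose P) ** G ** transpose P) *v axis i 1)"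
    by (simp add: inner_axis' matrix_vector_mult_basis column_def)
  then show "0 \<le> (P ** G ** transpose P) $ i $ i"
    using assms by (simp only: inner_congruence)
qed

theorem lemmaC2:
  fixes A :: "real^'n^'k"
    and Gamma_prior Gamma_post :: "real^'n^'n"
    and Gamma_noise :: "real^'k^'k"
    and delta_noise :: real
  assumes "symmetric_pos_def Gamma_prior"
    and "symmetric_pos_def Gamma_noise"
    and "Gamma_post =
      matrix_inv (matrix_inv Gamma_prior + transpose A ** matrix_inv Gamma_noise ** A)"
    and "delta_noise =
      trace (pseudoinverse A ** Gamma_noise ** transpose (pseudoinverse A)
             - pseudoinverse A ** A ** Gamma_post)"
  shows "delta_noise \<le> trace (pseudoinverse A ** Gamma_noise ** transpose (pseudoinverse A))"
proof -
  have prior: "0 < x \<bullet> (matrix_inv Gamma_prior *v x)" if "x \<noteq> 0" for x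
    using assms(1) that by (intro pos_def_matrix_inv) (auto simp: symmetric_pos_def_def)
  have noise: "0 < y \<bullet> (matrix_inv Gamma_noise *v y)" if "y \<noteq> 0" for y
    using assms(2) that by (intro pos_def_matrix_inv) (auto simp: symmetric_pos_def_def)
  let ?S = "matrix_inv Gamma_prior + transpose A ** matrix_inv Gamma_noise ** A"
  have S: "0 < x \<bullet> (?S *v x)" if "x \<noteq> 0" for x
  proof -
    have "0 \<le> (A *v x) \<bullet> (matrix_inv Gamma_noise *v (A *v x))"
      using noise[of "A *v x"] by (cases "A *v x = 0") auto
    with prior[OF that] show ?thesis
      by (simp add: matrix_vector_mult_add_rdistrib inner_add_right inner_congruence)
  qed
  have post: "0 \<le> x \<bullet> (Gamma_post *v x)" for x
    using pos_def_matrix_inv[OF S, of x] assms(3) by (cases "x = 0") auto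
  define P where "P = pseudoinverse A ** A"
  have P: "P ** P = P" "transpose P = P"
    using is_pseudoinverse_pseudoinverse[of A]
    by (simp_all add: P_def is_pseudoinverse_def matrix_mul_assoc)
  have "trace (P ** Gamma_post) = trace (P ** (P ** Gamma_post))"
    by (simp add: P matrix_mul_assoc)
  also have "\<dots> = trace (P ** Gamma_post ** transpose P)"
    by (simp add: P trace_mul_sym[of P])
  also have "\<dots> \<ge> 0"
    by (rule trace_congruence_nonneg) (rule post)
  finally show ?thesis
    by (simp add: assms(4) trace_sub P_def)
qed

end
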